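(* Let $G$ be a finite graph and let $k$ be a positive integer. If Maker has a winning strategy in the game of arboricity on $G$ with $k$ colours, then Maker also has a winning strategy in the game of arboricity on $G$ with $k+1$ colours.
   Context: The game of arboricity on a finite graph $G=(V,E)$ with $k$ colours is played by two players, Maker and Breaker, who alternately take turns, with Maker moving first. On each turn the player whose turn it is picks a previously uncoloured edge of $G$ and assigns to it one of the $k$ colours of a fixed palette, subject to the rule that no monochromatic cycle (a cycle of $G$ all of whose edges have been given the same colour) may be created. Maker wins if the whole edge set of $G$ is eventually coloured. Breaker wins if at some stage some uncoloured edge becomes unplayable, i.e. it cannot be given any colour of the palette without creating a monochromatic cycle. "Maker (Breaker) wins" means that this player has a winning strategy. *)

theory Defs
  imports Main
begin

text \<open>Finite undirected graphs, with edges named independently of their sets of endpoints, so that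
  parallel edges and loops are allowed.  The simple graph with edge set \<open>E\<close> of two-element
  sets of vertices is the case where \<open>ends\<close> is the identity.\<close>

record ('v, 'e) graph =
  verts :: "'v set"
  edges :: "'e set"
  ends :: "'e \<Rightarrow> 'v set"

definition finite_graph :: "('v, 'e) graph \<Rightarrow> bool" where
  "finite_graph G \<longleftrightarrow> finite (verts G) \<and> finite (edges G) \<and>
     (\<forall>e\<in>edges G. ends G e \<subseteq> verts G \<and> card (ends G e) \<in> {1, 2})"

text \<open>The edge \<open>es ! j\<close> joins \<open>vs ! j\<close> to its cyclic successor in \<open>vs\<close>.  Length 1 is a loop and
  length 2 is a pair of parallel edges; neither occurs in a simple graph.\<close>

definition is_cycle :: "('v, 'e) graph \<Rightarrow> 'v list \<Rightarrow> 'e list \<Rightarrow> bool" where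
  "is_cycle G vs es \<longleftrightarrow>
     es \<noteq> [] \<and> length vs = length es \<and> distinct vs \<and> distinct es \<and> set es \<subseteq> edges G \<and>
     (\<forall>j<length es. ends G (es ! j) = {vs ! j, vs ! (Suc j mod length es)})"

type_synonym 'e colouring = "'e \<Rightarrow> nat option"

definition has_mono_cycle :: "('v, 'e) graph \<Rightarrow> 'e colouring \<Rightarrow> bool" where
  "has_mono_cycle G c \<longleftrightarrow> (\<exists>vs es i. is_cycle G vs es \<and> (\<forall>e\<in>set es. c e = Some i))"

text \<open>The palette of \<open>k\<close> colours is \<open>{..<k}\<close>.\<close>

type_synonym 'e move = "'e \<times> nat"

fun legal :: "('v, 'e) graph \<Rightarrow> nat \<Rightarrow> 'e colouring \<Rightarrow> 'e move \<Rightarrow> bool" where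
  "legal G k c (e, i) \<longleftrightarrow>
     e \<in> edges G \<and> c e = None \<and> i < k \<and> \<not> has_mono_cycle G (c(e \<mapsto> i))"

definition maker_won :: "('v, 'e) graph \<Rightarrow> 'e colouring \<Rightarrow> bool" where
  "maker_won G c \<longleftrightarrow> (\<forall>e\<in>edges G. c e \<noteq> None)"

definition breaker_won :: "('v, 'e) graph \<Rightarrow> nat \<Rightarrow> 'e colouring \<Rightarrow> bool" where
  "breaker_won G k c \<longleftrightarrow> (\<exists>e\<in>edges G. c e = None \<and> (\<forall>i<k. \<not> legal G k c (e, i)))"

definition game_over :: "('v, 'e) graph \<Rightarrow> nat \<Rightarrow> 'e colouring \<Rightarrow> bool" where
  "game_over G k c \<longleftrightarrow> maker_won G c \<or> breaker_won G k c"

text \<open>A history lists the moves made so far, latest first, so that \<open>map_of h\<close> is the colouring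
  reached after \<open>h\<close>, and Maker, who starts, is to move when the length of \<open>h\<close> is even.
  A strategy for Maker may depend on the whole history.\<close>

type_synonym 'e history = "'e move list"
type_synonym 'e strategy = "'e history \<Rightarrow> 'e move"

inductive play_following :: "('v, 'e) graph \<Rightarrow> nat \<Rightarrow> 'e strategy \<Rightarrow> 'e history \<Rightarrow> bool"
  for G :: "('v, 'e) graph" and k :: nat and \<sigma> :: "'e strategy"
where
  start: "play_following G k \<sigma> []"
| maker: "play_following G k \<sigma> h \<Longrightarrow> even (length h) \<Longrightarrow> \<not> game_over G k (map_of h) \<Longrightarrow>
    legal G k (map_of h) (\<sigma> h) \<Longrightarrow> play_following G k \<sigma> (\<sigma> h # h)"
| breaker: "play_following G k \<sigma> h \<Longrightarrow> odd (length h) \<Longrightarrow> \<not> game_over G k (map_of h) \<Longrightarrow>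
    legal G k (map_of h) m \<Longrightarrow> play_following G k \<sigma> (m # h)"

text \<open>A winning strategy always prescribes a legal move when Maker has to move, and every play
  following it that has come to an end is won by Maker.  Every play does come to an end: each move
  colours a new edge, and while the game is not over there is a legal move.\<close>

definition winning_strategy :: "('v, 'e) graph \<Rightarrow> nat \<Rightarrow> 'e strategy \<Rightarrow> bool" where
  "winning_strategy G k \<sigma> \<longleftrightarrow>
     (\<forall>h. play_following G k \<sigma> h \<longrightarrow>
        (even (length h) \<and> \<not> game_over G k (map_of h) \<longrightarrow> legal G k (map_of h) (\<sigma> h)) \<and>
        (game_over G k (map_of h) \<longrightarrow> maker_won G (map_of h)))"

definition maker_wins :: "('v, 'e) graph \<Rightarrow> nat \<Rightarrow> bool" where
  "maker_wins G k \<longleftrightarrow> (\<exists>\<sigma>. winning_strategy G k \<sigma>)"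

end

theory Submission
  imports Defs
begin

text \<open>Call two vertices \<^emph>\<open>linked\<close> in a colour if a path of that colour joins them.  As long as there
  is no monochromatic cycle, giving an uncoloured edge the colour \<open>i\<close> is harmless exactly when its
  ends are not linked in \<open>i\<close>.  So the fewer links a position has, the more colours are legal for each
  of its uncoloured edges.

  With \<open>k + 1\<close> colours, Maker plays a shadow game with \<open>k\<close> colours alongside the real one, in which
  the same edges are coloured and Maker follows the given winning strategy, copying its moves to the
  real game.  A move of Breaker is copied to the shadow game if it is legal there; otherwise the
  same edge receives any colour that is legal in the shadow game, and there is one because the
  strategy wins.  The two positions may thus colour an edge differently, but for every colour
  \<open>i < k\<close> all vertices linked in the real position remain linked in the shadow position: a real
  move in colour \<open>i\<close> that could not be copied joins two vertices that were already linked in colour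
  \<open>i\<close> in the shadow position.  Hence every legal shadow move is a legal real move (lemma
  \<open>shadows_legal\<close>).  So the copied moves of Maker are legal, and an edge without a legal colour in
  the real game would have none in the shadow game.\<close>

section \<open>Monochromatic paths and cycles\<close>

definition adjacent :: "('v, 'e) graph \<Rightarrow> 'e colouring \<Rightarrow> nat \<Rightarrow> ('v \<times> 'v) set" where
  "adjacent G c i = {(u, v). \<exists>e\<in>edges G. c e = Some i \<and> ends G e = {u, v}}"

definition linked :: "('v, 'e) graph \<Rightarrow> 'e colouring \<Rightarrow> nat \<Rightarrow> ('v \<times> 'v) set" where
  "linked G c i = (adjacent G c i)\<^sup>*"

lemma linked_sym: "(u, v) \<in> linked G c i \<Longrightarrow> (v, u) \<in> linked G c i"
proof -
  have "sym (adjacent G c i)"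
    unfolding sym_def adjacent_def by (auto simp: insert_commute)
  then show "(u, v) \<in> linked G c i \<Longrightarrow> (v, u) \<in> linked G c i"
    unfolding linked_def by (meson sym_rtrancl symD)
qed

lemma linked_mono:
  "adjacent G c i \<subseteq> linked G d i \<Longrightarrow> linked G c i \<subseteq> linked G d i"
  unfolding linked_def by (rule rtrancl_subset_rtrancl)

definition is_path :: "('v, 'e) graph \<Rightarrow> 'e colouring \<Rightarrow> nat \<Rightarrow> 'v list \<Rightarrow> 'e list \<Rightarrow> bool" where
  "is_path G c i vs es \<longleftrightarrow>
     length vs = Suc (length es) \<and> distinct vs \<and>
     (\<forall>j<length es. es ! j \<in> edges G \<and> c (es ! j) = Some i \<and>
        ends G (es ! j) = {vs ! j, vs ! Suc j})"

text \<open>A path is extended by one edge at a time; when the new vertex already lies on the path, the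
  path is cut off there instead.\<close>

lemma linked_imp_path:
  assumes "(u, v) \<in> linked G c i"
  shows "\<exists>vs es. is_path G c i vs es \<and> vs ! 0 = u \<and> vs ! length es = v"
  using assms unfolding linked_def
proof (induction rule: rtrancl_induct)
  case base
  have "is_path G c i [u] []" by (simp add: is_path_def)
  then show ?case by fastforce
next
  case (step y z)
  then obtain vs es where path: "is_path G c i vs es" "vs ! 0 = u" "vs ! length es = y"
    by blast
  from step.hyps(2) obtain e where e: "e \<in> edges G" "c e = Some i" "ends G e = {y, z}"
    by (auto simp: adjacent_def)
  show ?case
  proof (cases "z \<in> set vs")
    case True
    then obtain p where p: "p < length vs" "vs ! p = z" by (auto simp: in_set_conv_nth)
    have "is_path G c i (take (Suc p) vs) (take p es)"
      using path(1) p(1) unfolding is_path_def by auto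
    moreover have "take (Suc p) vs ! 0 = u" using path(2) by simp
    moreover have "take (Suc p) vs ! length (take p es) = z"
      using path(1) p unfolding is_path_def by (auto simp: min_def dest: le_antisym)
    ultimately show ?thesis by blast
  next
    case False
    have "is_path G c i (vs @ [z]) (es @ [e])"
      using path False e unfolding is_path_def by (auto simp: nth_append less_Suc_eq)
    moreover have "(vs @ [z]) ! 0 = u" "(vs @ [z]) ! length (es @ [e]) = z"
      using path unfolding is_path_def by (auto simp: nth_append)
    ultimately show ?thesis by blast
  qed
qed

text \<open>The edges of a path are distinct because they have different pairs of ends.\<close>

lemma path_distinct_edges:
  assumes "is_path G c i vs es"
  shows "distinct es"
  unfolding distinct_conv_nth
proof (intro allI impI)
  fix j l assume jl: "j < length es" "l < length es" "j \<noteq> l"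
  have len: "length vs = Suc (length es)" and dist: "distinct vs"
    and ends: "\<And>j. j < length es \<Longrightarrow> ends G (es ! j) = {vs ! j, vs ! Suc j}"
    using assms unfolding is_path_def by auto
  have inj: "vs ! a = vs ! b \<longleftrightarrow> a = b" if "a \<le> length es" "b \<le> length es" for a b
    using nth_eq_iff_index_eq[OF dist] that len by simp
  show "es ! j \<noteq> es ! l"
  proof
    assume "es ! j = es ! l"
    then have "{vs ! j, vs ! Suc j} = {vs ! l, vs ! Suc l}"
      using ends[OF jl(1)] ends[OF jl(2)] by simp
    then have "j = l"
      using jl inj[of j l] inj[of j "Suc l"] inj[of "Suc j" l]
      by (simp add: doubleton_eq_iff) linarith
    then show False using jl(3) by simp
  qed
qed

lemma linked_imp_mono_cycle:
  assumes "e \<in> edges G" "c e = None" "ends G e = {u, v}" "(u, v) \<in> linked G c i"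
  shows "has_mono_cycle G (c(e \<mapsto> i))"
proof -
  obtain vs es where path: "is_path G c i vs es" and ends: "vs ! 0 = u" "vs ! length es = v"
    using linked_imp_path[OF assms(4)] by blast
  have len: "length vs = Suc (length es)" and dist: "distinct vs"
    and edge: "\<And>j. j < length es \<Longrightarrow> es ! j \<in> edges G \<and> c (es ! j) = Some i \<and>
        ends G (es ! j) = {vs ! j, vs ! Suc j}"
    using path unfolding is_path_def by auto
  have on_path: "x \<in> edges G \<and> c x = Some i" if "x \<in> set es" for x
    using that edge by (auto simp: in_set_conv_nth)
  have "is_cycle G vs (es @ [e])"
    unfolding is_cycle_def
  proof (intro conjI allI impI)
    show "distinct (es @ [e])" using path_distinct_edges[OF path] on_path assms(2) by auto
    fix j assume "j < length (es @ [e])"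
    then consider "j < length es" | "j = length es" by force
    then show "ends G ((es @ [e]) ! j) = {vs ! j, vs ! (Suc j mod length (es @ [e]))}"
      by cases (use edge ends assms(3) in \<open>auto simp: nth_append insert_commute\<close>)
  qed (use len dist on_path assms(1) in auto)
  moreover have "\<forall>x\<in>set (es @ [e]). (c(e \<mapsto> i)) x = Some i" using on_path by auto
  ultimately show ?thesis unfolding has_mono_cycle_def by blast
qed

text \<open>Conversely, going around a monochromatic cycle from one end of \<open>e\<close> to the other without
  using \<open>e\<close> gives a link.\<close>

lemma mono_cycle_imp_linked:
  assumes "\<not> has_mono_cycle G c" "has_mono_cycle G (c(e \<mapsto> i))" "ends G e = {u, v}"
  shows "(u, v) \<in> linked G c i"
proof -
  from assms(2) obtain vs es i' where cycle: "is_cycle G vs es"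
    and mono: "\<forall>x\<in>set es. (c(e \<mapsto> i)) x = Some i'"
    unfolding has_mono_cycle_def by blast
  have "e \<in> set es"
  proof (rule ccontr)
    assume "e \<notin> set es"
    then have "\<forall>x\<in>set es. c x = Some i'" using mono by (metis fun_upd_other)
    then show False using assms(1) cycle unfolding has_mono_cycle_def by blast
  qed
  then obtain j where j: "j < length es" "es ! j = e" by (auto simp: in_set_conv_nth)
  define n where "n = length es"
  have i': "i' = i" using mono \<open>e \<in> set es\<close> by auto
  have dist: "distinct es" and sub: "set es \<subseteq> edges G"
    and ends: "\<And>j. j < n \<Longrightarrow> ends G (es ! j) = {vs ! j, vs ! (Suc j mod n)}"
    using cycle unfolding is_cycle_def n_def by auto
  have n: "0 < n" using j n_def by (cases es) auto
  have walk: "(vs ! (Suc j mod n), vs ! ((Suc j + m) mod n)) \<in> linked G c i" if "m < n" for m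
    using that
  proof (induction m)
    case 0
    show ?case by (simp add: linked_def)
  next
    case (Suc m)
    let ?p = "(Suc j + m) mod n"
    have p: "?p < n" using n by simp
    have "?p \<noteq> j"
      using Suc.prems j n_def by (cases "Suc j + m < n") (auto simp: le_mod_geq)
    then have "es ! ?p \<noteq> e" using p j dist n_def by (metis nth_eq_iff_index_eq)
    moreover have "es ! ?p \<in> set es" using p n_def by simp
    ultimately have "es ! ?p \<in> edges G" "c (es ! ?p) = Some i"
      using mono i' sub by (auto split: if_splits)
    moreover have "ends G (es ! ?p) = {vs ! ?p, vs ! ((Suc j + Suc m) mod n)}"
      using ends[OF p] by (simp add: mod_Suc_eq)
    ultimately have "(vs ! ?p, vs ! ((Suc j + Suc m) mod n)) \<in> adjacent G c i"
      unfolding adjacent_def by blast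
    then show ?case using Suc unfolding linked_def by (meson Suc_lessD rtrancl.rtrancl_into_rtrancl)
  qed
  have "(Suc j + (n - 1)) mod n = j" using j n n_def by simp
  then have "(vs ! (Suc j mod n), vs ! j) \<in> linked G c i" using walk[of "n - 1"] n by simp
  moreover have "{u, v} = {vs ! j, vs ! (Suc j mod n)}" using ends[of j] j n_def assms(3) by simp
  ultimately show ?thesis by (metis doubleton_eq_iff linked_sym)
qed

lemma finite_graph_ends:
  assumes "finite_graph G" "e \<in> edges G"
  obtains u v where "ends G e = {u, v}"
proof -
  have "card (ends G e) = 1 \<or> card (ends G e) = 2"
    using assms unfolding finite_graph_def by auto
  then show thesis using that by (metis card_1_singletonE card_2_iff insert_absorb2)
qed

lemma not_mono_cycle_empty: "\<not> has_mono_cycle G Map.empty"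
  unfolding has_mono_cycle_def is_cycle_def by auto

section \<open>Positions that shadow one another\<close>

text \<open>In matroid terms, the span of each of the first \<open>k\<close> colour classes of the real position \<open>c\<close> is
  contained in the span of the corresponding class of the shadow position \<open>d\<close>.\<close>

definition shadows :: "('v, 'e) graph \<Rightarrow> nat \<Rightarrow> 'e colouring \<Rightarrow> 'e colouring \<Rightarrow> bool" where
  "shadows G k d c \<longleftrightarrow>
     dom d = dom c \<and> \<not> has_mono_cycle G c \<and> \<not> has_mono_cycle G d \<and>
     (\<forall>i<k. linked G c i \<subseteq> linked G d i)"

lemma shadows_legal:
  assumes "finite_graph G" "shadows G k d c" "legal G k d (e, i)" "k \<le> l"
  shows "legal G l c (e, i)"
proof -
  from assms(3) have e: "e \<in> edges G" "d e = None" "i < k" "\<not> has_mono_cycle G (d(e \<mapsto> i))"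
    by auto
  obtain u v where uv: "ends G e = {u, v}" using finite_graph_ends[OF assms(1) e(1)] .
  have "(u, v) \<notin> linked G d i" using linked_imp_mono_cycle[of e G d u v i] e uv by blast
  then have "(u, v) \<notin> linked G c i" using assms(2) e(3) unfolding shadows_def by blast
  then have "\<not> has_mono_cycle G (c(e \<mapsto> i))"
    using mono_cycle_imp_linked[OF _ _ uv] assms(2) unfolding shadows_def by blast
  moreover have "c e = None" using assms(2) e(2) unfolding shadows_def by (metis domIff)
  ultimately show ?thesis using e assms(4) by simp
qed

text \<open>An edge may receive different colours \<open>i\<close> and \<open>j\<close> in the two positions.  If \<open>i < k\<close>, this is
  allowed only when \<open>i\<close> is illegal in the shadow position; then the ends of the edge are
  already linked there in colour \<open>i\<close>, and the new real edge adds nothing to the span.\<close>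

lemma shadows_move:
  assumes fin: "finite_graph G" and sh: "shadows G k d c"
    and real: "legal G l c (e, i)" and shadow: "legal G k d (e, j)"
    and copied: "legal G k d (e, i) \<Longrightarrow> j = i"
  shows "shadows G k (d(e \<mapsto> j)) (c(e \<mapsto> i))"
proof -
  from real have e: "e \<in> edges G" "c e = None" by auto
  from shadow have de: "d e = None" by auto
  obtain u v where uv: "ends G e = {u, v}" using finite_graph_ends[OF fin e(1)] .
  have grow: "linked G d m \<subseteq> linked G (d(e \<mapsto> j)) m" for m
  proof -
    have "adjacent G d m \<subseteq> adjacent G (d(e \<mapsto> j)) m"
      unfolding adjacent_def using de by clarsimp (metis option.distinct(1))
    then show ?thesis unfolding linked_def by (rule rtrancl_mono)
  qed
  have new: "(u, v) \<in> linked G (d(e \<mapsto> j)) i" if "i < k"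
  proof (cases "legal G k d (e, i)")
    case True
    then have "(u, v) \<in> adjacent G (d(e \<mapsto> j)) i"
      using copied e(1) uv unfolding adjacent_def by auto
    then show ?thesis unfolding linked_def by blast
  next
    case False
    then have "has_mono_cycle G (d(e \<mapsto> i))" using e(1) de that by simp
    then have "(u, v) \<in> linked G d i"
      using mono_cycle_imp_linked[OF _ _ uv] sh unfolding shadows_def by blast
    then show ?thesis using grow by blast
  qed
  have "linked G (c(e \<mapsto> i)) m \<subseteq> linked G (d(e \<mapsto> j)) m" if m: "m < k" for m
  proof (rule linked_mono, rule subrelI)
    fix x y assume "(x, y) \<in> adjacent G (c(e \<mapsto> i)) m"
    then obtain a where a: "a \<in> edges G" "(c(e \<mapsto> i)) a = Some m" "ends G a = {x, y}"
      unfolding adjacent_def by blast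
    show "(x, y) \<in> linked G (d(e \<mapsto> j)) m"
    proof (cases "a = e")
      case True
      then have "m = i" and "{x, y} = {u, v}" using a uv by auto
      then show ?thesis using new m by (metis doubleton_eq_iff linked_sym)
    next
      case False
      then have "(x, y) \<in> adjacent G c m" using a unfolding adjacent_def by auto
      then have "(x, y) \<in> linked G c m" unfolding linked_def by blast
      then show ?thesis using sh m grow unfolding shadows_def by blast
    qed
  qed
  then show ?thesis using sh real shadow unfolding shadows_def by auto
qed

section \<open>The shadow game\<close>

fun shadow_move :: "('v, 'e) graph \<Rightarrow> nat \<Rightarrow> 'e colouring \<Rightarrow> 'e move \<Rightarrow> 'e move" where
  "shadow_move G k d (e, i) =
     (if legal G k d (e, i) then (e, i) else (e, SOME j. legal G k d (e, j)))"

text \<open>Every real move is translated in the same way, whoever made it: a move of Maker is legal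
  in the shadow game and therefore copied.\<close>

fun shadow_history :: "('v, 'e) graph \<Rightarrow> nat \<Rightarrow> 'e history \<Rightarrow> 'e history" where
  "shadow_history G k [] = []"
| "shadow_history G k (m # h) =
     shadow_move G k (map_of (shadow_history G k h)) m # shadow_history G k h"

lemma length_shadow_history [simp]: "length (shadow_history G k h) = length h"
  by (induction h) auto

lemma shadow_move_legal:
  assumes "\<exists>j. legal G k d (e, j)"
  shows "legal G k d (shadow_move G k d (e, i))"
proof (cases "legal G k d (e, i)")
  case False
  then show ?thesis using someI_ex[OF assms] by (simp del: legal.simps)
qed (simp del: legal.simps)

lemma shadows_shadow_move:
  assumes "finite_graph G" "shadows G k d c" "legal G l c m" "\<exists>j. legal G k d (fst m, j)"
  shows "shadows G k (d(fst (shadow_move G k d m) \<mapsto> snd (shadow_move G k d m)))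
           (c(fst m \<mapsto> snd m))"
proof -
  obtain e i where m: "m = (e, i)" by (cases m)
  obtain j where j: "shadow_move G k d (e, i) = (e, j)" "legal G k d (e, i) \<Longrightarrow> j = i"
    by (cases "legal G k d (e, i)") (auto simp del: legal.simps)
  have "legal G k d (e, j)" using shadow_move_legal[of G k d e i] assms(4) j m by simp
  then show ?thesis using shadows_move[OF assms(1,2), of l e i j] assms(3) j m by simp
qed

text \<open>An edge that is uncoloured in the real game is uncoloured in the shadow game too, and a shadow
  game that ended with an uncoloured edge would be a loss for the winning strategy.\<close>

lemma shadow_not_over:
  assumes "winning_strategy G k \<sigma>" "play_following G k \<sigma> h'"
    and "shadows G k (map_of h') c" "\<not> maker_won G c"
  shows "\<not> game_over G k (map_of h')"
proof -
  have "\<not> maker_won G (map_of h')"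
    using assms(3,4) unfolding maker_won_def shadows_def by (metis domIff)
  then show ?thesis using assms(1,2) unfolding winning_strategy_def by blast
qed

lemma not_over_legal_colour:
  assumes "\<not> game_over G k d" "e \<in> edges G" "d e = None"
  shows "\<exists>j. legal G k d (e, j)"
  using assms unfolding game_over_def breaker_won_def by blast

lemma shadow_play:
  assumes fin: "finite_graph G" and win: "winning_strategy G k \<sigma>"
    and "play_following G l (\<lambda>h. \<sigma> (shadow_history G k h)) h"
  shows "play_following G k \<sigma> (shadow_history G k h) \<and>
    shadows G k (map_of (shadow_history G k h)) (map_of h)"
  using assms(3)
proof (induction rule: play_following.induct)
  case start
  show ?case
    using not_mono_cycle_empty by (auto simp: play_following.start shadows_def)
next
  case (maker h)
  let ?s = "shadow_history G k h"
  have over: "\<not> game_over G k (map_of ?s)"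
    using shadow_not_over[OF win] maker unfolding game_over_def by blast
  then have legal: "legal G k (map_of ?s) (\<sigma> ?s)"
    using win maker unfolding winning_strategy_def by simp
  then have copied: "shadow_move G k (map_of ?s) (\<sigma> ?s) = \<sigma> ?s"
    by (cases "\<sigma> ?s") (simp del: legal.simps)
  have "\<exists>j. legal G k (map_of ?s) (fst (\<sigma> ?s), j)" using legal by (metis prod.collapse)
  then have "shadows G k (map_of (shadow_history G k (\<sigma> ?s # h))) (map_of (\<sigma> ?s # h))"
    using shadows_shadow_move[OF fin _ maker.hyps(4)] maker.IH by simp
  moreover have "play_following G k \<sigma> (\<sigma> ?s # ?s)"
    using play_following.maker[of G k \<sigma> ?s] maker over legal by simp
  ultimately show ?case by (simp only: shadow_history.simps copied)
next
  case (breaker h m)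
  let ?s = "shadow_history G k h"
  have over: "\<not> game_over G k (map_of ?s)"
    using shadow_not_over[OF win] breaker unfolding game_over_def by blast
  have "fst m \<in> edges G" "map_of h (fst m) = None" using breaker.hyps(4) by (cases m; simp)+
  then have ex: "\<exists>j. legal G k (map_of ?s) (fst m, j)"
    using not_over_legal_colour[OF over] breaker.IH unfolding shadows_def by (metis domIff)
  then have "shadows G k (map_of (shadow_history G k (m # h))) (map_of (m # h))"
    using shadows_shadow_move[OF fin _ breaker.hyps(4)] breaker.IH by simp
  moreover have "play_following G k \<sigma> (shadow_move G k (map_of ?s) m # ?s)"
    using play_following.breaker[of G k \<sigma> ?s] breaker over ex
      shadow_move_legal[of G k "map_of ?s" "fst m" "snd m"] by simp
  ultimately show ?case by (simp only: shadow_history.simps)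
qed

lemma winning_strategy_shadow:
  assumes fin: "finite_graph G" and win: "winning_strategy G k \<sigma>" and "k \<le> l"
  shows "winning_strategy G l (\<lambda>h. \<sigma> (shadow_history G k h))"
  unfolding winning_strategy_def
proof (intro allI impI conjI)
  fix h assume "play_following G l (\<lambda>h. \<sigma> (shadow_history G k h)) h"
  let ?s = "shadow_history G k h"
  have play: "play_following G k \<sigma> ?s" and sh: "shadows G k (map_of ?s) (map_of h)"
    using shadow_play[OF fin win] \<open>play_following G l _ h\<close> by auto
  note not_over = shadow_not_over[OF win play sh]
  {
    assume h: "even (length h) \<and> \<not> game_over G l (map_of h)"
    then have "legal G k (map_of ?s) (\<sigma> ?s)"
      using not_over win play unfolding winning_strategy_def game_over_def[of G l] by simp
    then show "legal G l (map_of h) (\<sigma> ?s)"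
      using shadows_legal[OF fin sh _ \<open>k \<le> l\<close>] by (metis prod.collapse)
  next
    assume over: "game_over G l (map_of h)"
    show "maker_won G (map_of h)"
    proof (rule ccontr)
      assume not_won: "\<not> maker_won G (map_of h)"
      then obtain e where e: "e \<in> edges G" "map_of h e = None"
        and stuck: "\<forall>i<l. \<not> legal G l (map_of h) (e, i)"
        using over unfolding game_over_def breaker_won_def by blast
      have "map_of ?s e = None" using sh e(2) unfolding shadows_def by (metis domIff)
      then obtain j where "legal G k (map_of ?s) (e, j)"
        using not_over_legal_colour[OF not_over[OF not_won] e(1)] by blast
      then have "legal G l (map_of h) (e, j)" by (rule shadows_legal[OF fin sh _ \<open>k \<le> l\<close>])
      moreover from this have "j < l" by simp
      ultimately show False using stuck by blast
    qed
  }
qed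

theorem theorem1p3:
  fixes G :: "('v, 'e) graph" and k :: nat
  assumes "finite_graph G"
    and "k > 0"
    and "maker_wins G k"
  shows "maker_wins G (k + 1)"
  using winning_strategy_shadow[OF assms(1), of k _ "k + 1"] assms(3)
  unfolding maker_wins_def by auto

end
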